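(* Let $G$ be a finite group and let $U\le G$ be a subgroup. Then the algorithm $\mathtt{IntermediateSubgroups}(G,U)$ described in the context is correct, i.e. it returns a pair $(\mathcal S, I)$ such that: (1) $\mathcal S$ is a list consisting of $G$ together with exactly the intermediate subgroups $V$ with $U<V<G$; (2) $I$ is a list consisting of exactly the maximality inclusions amongst all subgroups $V$ with $U\le V\le G$, i.e. the relations $X<T$ with $U\le X<T\le G$ and $X$ a maximal subgroup of $T$.
   Context: Notation: $<$ denotes proper containment of subgroups, $[T:U]$ is the index, and $A^g=g^{-1}Ag$. A subgroup $X<T$ is maximal in $T$ if there is no subgroup $Y$ with $X<Y<T$. Subroutine: for a finite group $T$ and subgroups $W,U\le T$, $\mathtt{EmbeddingConjugates}(T,W,U)$ returns the list of the $T$-conjugates of $W$ containing $U$, that is the subgroups $W^g>U$ with $g\in T$ (together with the respective conjugating elements $g$, which are not needed here). This subroutine is assumed to be correct. Algorithm $\mathtt{IntermediateSubgroups}(G,U)$. Input: groups $G\ge U$. It maintains a list $\mathcal S$ of subgroups of $G$, each either marked as processed or not, and a list $I$ of relations $X<T$ (recorded as ordered pairs of subgroups). 1. Initialize $\mathcal S:=[G]$ (with $G$ not processed) and $I:=[\,]$. 2. While there is a subgroup $T\in\mathcal S$ that has not been processed, perform the following steps for $T$; otherwise end and return $\mathcal S$ and $I$. 3. If $[T:U]$ is prime, record $U<T$ as a maximality relation in $I$, mark $T$ as processed, and go back to step 2. 4. Determine a list $\mathcal M$ of representatives, up to $T$-conjugacy, of the maximal subgroups of $T$ whose order is a multiple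 of $|U|$. 5. For each subgroup $W\in\mathcal M$ let $\mathcal V_W=\mathtt{EmbeddingConjugates}(T,W,U)$ (that is, the $T$-conjugates of $W$ containing $U$). Add every subgroup $X\in\mathcal V_W$ to $\mathcal S$ (unless it is already in the list), and add the maximality relations $X<T$ to $I$. 6. If all sets $\mathcal V_W$ were empty, add the maximality relation $U<T$ to $I$. 7. Mark $T$ as processed, and go back to step 2.
   Formalization: In step 6 the relation U<T is recorded only if U is a proper subgroup of T; this matters only for U=G, where the algorithm as written would record G<G and claim (2) would fail. *)

theory Defs
  imports "HOL-Algebra.Coset" "HOL-Computational_Algebra.Primes"
begin

text \<open>
  All groups occurring are subgroups of one ambient group \<open>G\<close> and are represented by their
  carrier sets, so that containment is \<open>\<subseteq>\<close> and proper containment is \<open>\<subset>\<close>.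
\<close>

definition subgroup_index :: "('a, 'b) monoid_scheme \<Rightarrow> 'a set \<Rightarrow> 'a set \<Rightarrow> nat" where
  "subgroup_index G T U = card (rcosets\<^bsub>G\<lparr>carrier := T\<rparr>\<^esub> U)"

definition maximal_subgroup :: "('a, 'b) monoid_scheme \<Rightarrow> 'a set \<Rightarrow> 'a set \<Rightarrow> bool" where
  "maximal_subgroup G T X \<longleftrightarrow>
     subgroup T G \<and> subgroup X G \<and> X \<subset> T \<and> (\<nexists>Y. subgroup Y G \<and> X \<subset> Y \<and> Y \<subset> T)"

definition conj_subgroup :: "('a, 'b) monoid_scheme \<Rightarrow> 'a set \<Rightarrow> 'a \<Rightarrow> 'a set" where
  "conj_subgroup G W g = (\<lambda>w. inv\<^bsub>G\<^esub> g \<otimes>\<^bsub>G\<^esub> w \<otimes>\<^bsub>G\<^esub> g) ` W"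

text \<open>
  The specification of the subroutine: \<open>L\<close> is a correct output of \<open>EmbeddingConjugates(T,W,U)\<close>.
  The order of the list is left open.
\<close>

definition embedding_conjugates ::
  "('a, 'b) monoid_scheme \<Rightarrow> 'a set \<Rightarrow> 'a set \<Rightarrow> 'a set \<Rightarrow> 'a set list \<Rightarrow> bool" where
  "embedding_conjugates G T W U L \<longleftrightarrow>
     distinct L \<and> set L = {conj_subgroup G W g | g. g \<in> T \<and> U \<subset> conj_subgroup G W g}"

definition maximal_representatives ::
  "('a, 'b) monoid_scheme \<Rightarrow> 'a set \<Rightarrow> 'a set \<Rightarrow> 'a set list \<Rightarrow> bool" where
  "maximal_representatives G T U Ms \<longleftrightarrow>
     distinct Ms \<and>
     (\<forall>W \<in> set Ms. maximal_subgroup G T W \<and> card U dvd card W) \<and>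
     (\<forall>X. maximal_subgroup G T X \<and> card U dvd card X \<longrightarrow>
        (\<exists>!W. W \<in> set Ms \<and> (\<exists>g \<in> T. X = conj_subgroup G W g)))"

text \<open>
  A state \<open>(S, P, I)\<close> consists of the list of subgroups found so far, the set of those marked as
  processed, and the list of recorded relations, where \<open>(X, T)\<close> stands for \<open>X < T\<close>.
\<close>

type_synonym 'a isub_state = "'a set list \<times> 'a set set \<times> ('a set \<times> 'a set) list"

definition isub_init :: "('a, 'b) monoid_scheme \<Rightarrow> 'a isub_state" where
  "isub_init G = ([carrier G], {}, [])"

definition isub_done :: "'a isub_state \<Rightarrow> bool" where
  "isub_done s = (case s of (S, P, I) \<Rightarrow> set S \<subseteq> P)"

text \<open>
  One pass through the loop body. It is a relation because the algorithm leaves open which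
  unprocessed \<open>T\<close> is taken, which representatives \<open>Ms\<close> are chosen, and in which order lists are
  produced. Since \<open><\<close> is proper containment, the relation \<open>U < T\<close> which is to be recorded
  when no conjugates were found makes sense only if \<open>U \<noteq> T\<close>. The condition \<open>U \<subset> T\<close> below is
  automatic unless the algorithm is started with \<open>U = G\<close>, as every other subgroup which gets
  into the list properly contains \<open>U\<close>; for \<open>U = G\<close> it prevents recording the pair \<open>(G, G)\<close>.
\<close>

inductive isub_step ::
  "('a, 'b) monoid_scheme \<Rightarrow> 'a set \<Rightarrow> 'a isub_state \<Rightarrow> 'a isub_state \<Rightarrow> bool"
  for G :: "('a, 'b) monoid_scheme" and U :: "'a set" where
  prime_index:
    "\<lbrakk>T \<in> set S; T \<notin> P; prime (subgroup_index G T U)\<rbrakk>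
     \<Longrightarrow> isub_step G U (S, P, I) (S, insert T P, I @ [(U, T)])"
| other_index:
    "\<lbrakk>T \<in> set S; T \<notin> P; \<not> prime (subgroup_index G T U);
      maximal_representatives G T U Ms;
      \<forall>W \<in> set Ms. embedding_conjugates G T W U (V W);
      Xs = concat (map V Ms)\<rbrakk>
     \<Longrightarrow> isub_step G U (S, P, I)
           (fold List.insert Xs S,
            insert T P,
            I @ map (\<lambda>X. (X, T)) Xs @
              (if (\<forall>W \<in> set Ms. V W = []) \<and> U \<subset> T then [(U, T)] else []))"

text \<open>
  Every way of executing the algorithm comes to an end, and it never gets stuck
  before all subgroups in the list have been processed.
\<close>

definition isub_terminates :: "('a, 'b) monoid_scheme \<Rightarrow> 'a set \<Rightarrow> bool" where
  "isub_terminates G U \<longleftrightarrow>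
     (\<nexists>f. f 0 = isub_init G \<and> (\<forall>n::nat. isub_step G U (f n) (f (Suc n)))) \<and>
     (\<forall>s. (isub_step G U)\<^sup>*\<^sup>* (isub_init G) s \<and> \<not> isub_done s \<longrightarrow> (\<exists>s'. isub_step G U s s'))"

definition isub_returns ::
  "('a, 'b) monoid_scheme \<Rightarrow> 'a set \<Rightarrow> 'a set list \<Rightarrow> ('a set \<times> 'a set) list \<Rightarrow> bool" where
  "isub_returns G U S I \<longleftrightarrow>
     (\<exists>P. (isub_step G U)\<^sup>*\<^sup>* (isub_init G) (S, P, I) \<and> isub_done (S, P, I))"

end

theory Submission
  imports Defs
begin

text \<open>
  The heart of the matter is that one pass of the loop at a subgroup \<open>T \<supseteq> U\<close> records exactly
  the pairs \<open>(X, T)\<close> with \<open>X\<close> a maximal subgroup of \<open>T\<close> containing \<open>U\<close>, each of them once, and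
  that it adds to the list of subgroups exactly those \<open>X\<close> that differ from \<open>U\<close>
  (\<open>isub_step_effect\<close>). If \<open>[T:U]\<close> is prime, then by Lagrange's theorem \<open>U\<close> is the only such
  \<open>X\<close>. Otherwise the maximal subgroups properly above \<open>U\<close> are found as conjugates, under \<open>T\<close>, of
  the representatives: maximality is invariant under conjugation by elements of \<open>T\<close>, and the order
  of a subgroup above \<open>U\<close> is a multiple of \<open>|U|\<close>. No subgroup is found twice because distinct
  representatives are not conjugate. The relation \<open>U < T\<close> is a maximality relation precisely if
  there is no maximal subgroup of \<open>T\<close> properly above \<open>U\<close>, since in a finite group every
  proper subgroup of \<open>T\<close> lies in a maximal one.

  This makes the following an invariant (\<open>isub_invariant\<close>): the recorded relations are the
  maximality relations above \<open>U\<close> whose larger member has been processed, and the list of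
  subgroups is closed under passing from a processed \<open>T\<close> to its maximal subgroups properly above
  \<open>U\<close>. When everything has been processed, no intermediate \<open>V\<close> can be missing: \<open>G\<close> is in the list,
  so there is a smallest \<open>T \<supset> V\<close> in the list, and a maximal subgroup of \<open>T\<close> containing \<open>V\<close>
  would be in the list too and would either be \<open>V\<close> or contradict the choice of \<open>T\<close>
  (\<open>maximal_closed_contains_all\<close>).

  Each pass marks a new subgroup as processed, and \<open>G\<close> has only finitely many of them, so every
  execution is finite. It does not get stuck, because conjugacy under \<open>T\<close> is an equivalence
  relation and therefore representatives of the maximal subgroups can be chosen.
\<close>

section \<open>Conjugation and maximal subgroups\<close>

definition maximal_above :: "('a, 'b) monoid_scheme \<Rightarrow> 'a set \<Rightarrow> 'a set \<Rightarrow> 'a set set" where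
  "maximal_above G U T = {X. maximal_subgroup G T X \<and> U \<subseteq> X}"

context group
begin

lemma conj_subgroup_conj_subgroup:
  assumes "W \<subseteq> carrier G" "g \<in> carrier G" "h \<in> carrier G"
  shows "conj_subgroup G (conj_subgroup G W g) h = conj_subgroup G W (g \<otimes> h)"
proof -
  have "inv h \<otimes> (inv g \<otimes> w \<otimes> g) \<otimes> h = inv (g \<otimes> h) \<otimes> w \<otimes> (g \<otimes> h)" if "w \<in> W" for w
  proof -
    have "w \<in> carrier G" using that assms(1) by blast
    then show ?thesis using assms by (simp add: inv_mult_group m_assoc)
  qed
  then show ?thesis
    unfolding conj_subgroup_def image_image by (intro image_cong refl)
qed

lemma conj_subgroup_one:
  assumes "W \<subseteq> carrier G"
  shows "conj_subgroup G W \<one> = W"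
proof -
  have "inv \<one> \<otimes> w \<otimes> \<one> = w" if "w \<in> W" for w
    using that assms by (simp add: subset_iff)
  then show ?thesis unfolding conj_subgroup_def by simp
qed

lemma conj_subgroup_inverse:
  assumes "W \<subseteq> carrier G" "g \<in> carrier G"
  shows "conj_subgroup G (conj_subgroup G W g) (inv g) = W"
    and "conj_subgroup G (conj_subgroup G W (inv g)) g = W"
  using assms by (simp_all add: conj_subgroup_conj_subgroup conj_subgroup_one)

lemma conj_subgroup_is_subgroup:
  assumes "subgroup W G" "g \<in> carrier G"
  shows "subgroup (conj_subgroup G W g) G"
proof (rule subgroupI)
  note W = subgroup.mem_carrier[OF assms(1)]
  show "conj_subgroup G W g \<subseteq> carrier G"
    using W assms(2) by (auto simp: conj_subgroup_def)
  show "conj_subgroup G W g \<noteq> {}"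
    using subgroup.one_closed[OF assms(1)] by (auto simp: conj_subgroup_def)
  show "inv a \<in> conj_subgroup G W g" if a: "a \<in> conj_subgroup G W g" for a
  proof -
    obtain w where w: "w \<in> W" "a = inv g \<otimes> w \<otimes> g"
      using a by (auto simp: conj_subgroup_def)
    have "inv a = inv g \<otimes> inv w \<otimes> g"
      using w W assms(2) by (simp add: inv_mult_group m_assoc)
    then show ?thesis
      using subgroup.m_inv_closed[OF assms(1) w(1)] by (auto simp: conj_subgroup_def)
  qed
  show "a \<otimes> b \<in> conj_subgroup G W g"
    if ab: "a \<in> conj_subgroup G W g" "b \<in> conj_subgroup G W g" for a b
  proof -
    obtain v w where vw: "v \<in> W" "a = inv g \<otimes> v \<otimes> g" "w \<in> W" "b = inv g \<otimes> w \<otimes> g"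
      using ab by (auto simp: conj_subgroup_def)
    have "g \<otimes> (inv g \<otimes> (w \<otimes> g)) = w \<otimes> g"
      using vw W assms(2) by (simp flip: m_assoc)
    then have "a \<otimes> b = inv g \<otimes> (v \<otimes> w) \<otimes> g"
      using vw W assms(2) by (simp add: m_assoc)
    then show ?thesis
      using subgroup.m_closed[OF assms(1) vw(1,3)] by (auto simp: conj_subgroup_def)
  qed
qed

lemma conj_subgroup_mono: "V \<subseteq> W \<Longrightarrow> conj_subgroup G V g \<subseteq> conj_subgroup G W g"
  unfolding conj_subgroup_def by blast

lemma conj_subgroup_strict_mono:
  assumes "V \<subset> W" "W \<subseteq> carrier G" "g \<in> carrier G"
  shows "conj_subgroup G V g \<subset> conj_subgroup G W g"
proof -
  have "V \<subseteq> carrier G" using assms by blast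
  then have "conj_subgroup G V g \<noteq> conj_subgroup G W g"
    using assms conj_subgroup_inverse(1) by (metis psubset_eq)
  then show ?thesis using conj_subgroup_mono assms(1) by blast
qed

lemma conj_subgroup_self:
  assumes "subgroup T G" "g \<in> T"
  shows "conj_subgroup G T g = T"
proof -
  have sub: "conj_subgroup G T h \<subseteq> T" if "h \<in> T" for h
    using that assms(1)
    by (auto simp: conj_subgroup_def intro!: subgroup.m_closed subgroup.m_inv_closed)
  have T: "T \<subseteq> carrier G" using assms(1) by (rule subgroup.subset)
  have "T = conj_subgroup G (conj_subgroup G T (inv g)) g"
    using conj_subgroup_inverse(2)[OF T] assms(2) T by auto
  also have "\<dots> \<subseteq> conj_subgroup G T g"
    by (rule conj_subgroup_mono[OF sub[OF subgroup.m_inv_closed[OF assms]]])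
  finally show ?thesis using sub[OF assms(2)] by blast
qed

lemma maximal_subgroup_conj:
  assumes max: "maximal_subgroup G T X" and g: "g \<in> T"
  shows "maximal_subgroup G T (conj_subgroup G X g)"
proof -
  have T: "subgroup T G" and X: "subgroup X G" and XT: "X \<subset> T"
    and no: "\<And>Y. subgroup Y G \<Longrightarrow> X \<subset> Y \<Longrightarrow> Y \<subset> T \<Longrightarrow> False"
    using max by (auto simp: maximal_subgroup_def)
  have Tc: "T \<subseteq> carrier G" and Xc: "X \<subseteq> carrier G" and gc: "g \<in> carrier G"
    using T X g subgroup.subset by blast+
  have ig: "inv g \<in> T" by (rule subgroup.m_inv_closed[OF T g])
  have sub: "subgroup (conj_subgroup G X g) G"
    by (rule conj_subgroup_is_subgroup[OF X gc])
  have "conj_subgroup G X g \<subset> T"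
    using conj_subgroup_strict_mono[OF XT Tc gc] conj_subgroup_self[OF T g] by simp
  moreover have False if Y: "subgroup Y G" "conj_subgroup G X g \<subset> Y" "Y \<subset> T" for Y
  proof (rule no)
    show "subgroup (conj_subgroup G Y (inv g)) G"
      by (rule conj_subgroup_is_subgroup[OF Y(1) inv_closed[OF gc]])
    show "X \<subset> conj_subgroup G Y (inv g)"
      using conj_subgroup_strict_mono[OF Y(2) subgroup.subset[OF Y(1)] inv_closed[OF gc]]
        conj_subgroup_inverse(1)[OF Xc gc] by simp
    show "conj_subgroup G Y (inv g) \<subset> T"
      using conj_subgroup_strict_mono[OF Y(3) Tc inv_closed[OF gc]] conj_subgroup_self[OF T ig]
      by simp
  qed
  ultimately show ?thesis using T sub by (auto simp: maximal_subgroup_def)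
qed

lemma contained_in_maximal_subgroup:
  assumes fin: "finite (carrier G)" and Y: "subgroup Y G" and T: "subgroup T G" and YT: "Y \<subset> T"
  obtains X where "maximal_subgroup G T X" "Y \<subseteq> X"
proof -
  let ?A = "{X. subgroup X G \<and> X \<subset> T}"
  have "?A \<subseteq> Pow (carrier G)" using subgroup.subset by blast
  then have "finite ?A" using fin by (simp add: finite_subset)
  moreover have "Y \<in> ?A" using Y YT by blast
  ultimately have "\<exists>X\<in>?A. Y \<subseteq> X \<and> (\<forall>Z\<in>?A. X \<subseteq> Z \<longrightarrow> X = Z)"
    by (rule finite_has_maximal2)
  then obtain X where X: "X \<in> ?A" "Y \<subseteq> X" and top: "\<forall>Z\<in>?A. X \<subseteq> Z \<longrightarrow> X = Z"
    by (elim bexE conjE)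
  then have "maximal_subgroup G T X"
    using T by (auto simp: maximal_subgroup_def)
  then show thesis using X(2) by (rule that)
qed

lemma card_subgroup_index:
  assumes "subgroup T G" "subgroup U G" "U \<subseteq> T"
  shows "subgroup_index G T U * card U = card T"
  using group.lagrange[OF subgroup_imp_group[OF assms(1)] subgroup_incl[OF assms(2,1,3)]]
  by (simp add: subgroup_index_def order_def)

lemma card_subgroup_dvd:
  assumes "subgroup T G" "subgroup U G" "U \<subseteq> T"
  shows "card U dvd card T"
  by (metis card_subgroup_index[OF assms] dvd_triv_right)

text \<open>
  A subgroup \<open>X\<close> with \<open>U \<subseteq> X \<subset> T\<close> gives a factorization \<open>[T:X] [X:U]\<close> of the prime \<open>[T:U]\<close> with
  \<open>[T:X] \<noteq> 1\<close>, whence \<open>[X:U] = 1\<close>.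
\<close>

lemma prime_index_between:
  assumes fin: "finite (carrier G)" and T: "subgroup T G" and U: "subgroup U G" and X: "subgroup X G"
    and p: "prime (subgroup_index G T U)" and "U \<subseteq> X" "X \<subset> T"
  shows "X = U"
proof -
  have finT: "finite T" and finX: "finite X"
    using fin T X by (meson finite_subset subgroup.subset)+
  have Upos: "card U > 0"
    using finite_subset[OF \<open>U \<subseteq> X\<close> finX] subgroup.one_closed[OF U] by (auto simp: card_gt_0_iff)
  have iTU: "subgroup_index G T U * card U = card T"
    and iTX: "subgroup_index G T X * card X = card T"
    and iXU: "subgroup_index G X U * card U = card X"
    using assms by (auto intro!: card_subgroup_index)
  have "subgroup_index G T U * card U = (subgroup_index G T X * subgroup_index G X U) * card U"
    using iTU iTX iXU by (simp add: mult.assoc)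
  then have "subgroup_index G T U = subgroup_index G T X * subgroup_index G X U"
    using Upos by simp
  then have "subgroup_index G T X = 1 \<or> subgroup_index G X U = 1"
    using p by (metis prime_product)
  moreover have "subgroup_index G T X \<noteq> 1"
    using iTX psubset_card_mono[OF finT \<open>X \<subset> T\<close>] by auto
  ultimately have "card X = card U" using iXU by auto
  then show ?thesis using card_subset_eq[OF finX \<open>U \<subseteq> X\<close>] by simp
qed

lemma maximal_above_prime_index:
  assumes fin: "finite (carrier G)" and T: "subgroup T G" and U: "subgroup U G" and "U \<subseteq> T"
    and p: "prime (subgroup_index G T U)"
  shows "maximal_above G U T = {U}"
proof -
  have "U \<noteq> T"
  proof
    assume "U = T"
    have "card T > 0"
      using finite_subset[OF subgroup.subset[OF T] fin] subgroup.one_closed[OF T]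
      by (auto simp: card_gt_0_iff)
    then have "subgroup_index G T U = 1"
      using card_subgroup_index[OF T U] \<open>U = T\<close> by simp
    then show False using p by simp
  qed
  then have "U \<subset> T" using \<open>U \<subseteq> T\<close> by blast
  have between: "X = U" if "subgroup X G" "U \<subseteq> X" "X \<subset> T" for X
    using prime_index_between[OF fin T U that(1) p that(2,3)] .
  have "maximal_subgroup G T U"
    using between T U \<open>U \<subset> T\<close> by (auto simp: maximal_subgroup_def)
  then show ?thesis
    using between by (auto simp: maximal_above_def maximal_subgroup_def)
qed

text \<open>
  This justifies recording \<open>U < T\<close> when no conjugates were found: a proper subgroup lies in some
  maximal one, and if that can only be \<open>U\<close>, then \<open>U\<close> is itself maximal.
\<close>

lemma bottom_in_maximal_above_iff:
  assumes fin: "finite (carrier G)" and T: "subgroup T G" and U: "subgroup U G"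
  shows "U \<in> maximal_above G U T \<longleftrightarrow> U \<subset> T \<and> maximal_above G U T - {U} = {}"
proof
  assume *: "U \<in> maximal_above G U T"
  then show "U \<subset> T \<and> maximal_above G U T - {U} = {}"
    unfolding maximal_above_def maximal_subgroup_def by blast
next
  assume *: "U \<subset> T \<and> maximal_above G U T - {U} = {}"
  then obtain X where "maximal_subgroup G T X" "U \<subseteq> X"
    using contained_in_maximal_subgroup[OF fin U T] by blast
  then have "X \<in> maximal_above G U T" by (simp add: maximal_above_def)
  with * show "U \<in> maximal_above G U T" by blast
qed

section \<open>Representatives up to conjugacy\<close>

text \<open>
  Sending each maximal subgroup to a chosen element of its conjugacy class makes the value depend
  on the class only, which gives uniqueness of representatives.
\<close>

lemma maximal_representatives_exist:
  assumes fin: "finite (carrier G)" and T: "subgroup T G"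
  shows "\<exists>Ms. maximal_representatives G T U Ms"
proof -
  define M where "M = {X. maximal_subgroup G T X \<and> card U dvd card X}"
  define R where "R X W \<longleftrightarrow> (\<exists>g\<in>T. X = conj_subgroup G W g)" for X W
  define rep where "rep X = (SOME W. W \<in> M \<and> R X W)" for X
  have M_sub: "X \<subseteq> carrier G" if "X \<in> M" for X
    using that subgroup.subset by (auto simp: M_def maximal_subgroup_def)
  have T_sub: "T \<subseteq> carrier G" by (rule subgroup.subset[OF T])
  have R_refl: "R X X" if "X \<in> M" for X
    unfolding R_def using conj_subgroup_one[OF M_sub[OF that]] subgroup.one_closed[OF T] by metis
  have R_sym: "R W X" if "R X W" "W \<in> M" for X W
    using that conj_subgroup_inverse(1)[OF M_sub[OF that(2)]] subgroup.m_inv_closed[OF T] T_sub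
    unfolding R_def by (metis subsetD)
  have R_trans: "R X Z" if "R X Y" "R Y Z" "Z \<in> M" for X Y Z
    using that conj_subgroup_conj_subgroup[OF M_sub[OF that(3)]] subgroup.m_closed[OF T] T_sub
    unfolding R_def by (metis subsetD)
  have rep: "rep X \<in> M \<and> R X (rep X)" if "X \<in> M" for X
    unfolding rep_def by (rule someI[of _ X]) (use that R_refl in auto)
  have rep_cong: "rep X = rep W" if "R X W" "X \<in> M" "W \<in> M" for X W
  proof -
    have "(\<lambda>Z. Z \<in> M \<and> R X Z) = (\<lambda>Z. Z \<in> M \<and> R W Z)"
      using that R_sym R_trans by blast
    then show ?thesis unfolding rep_def by simp
  qed
  have "M \<subseteq> Pow (carrier G)" using M_sub by blast
  then have "finite (rep ` M)" using fin by (simp add: finite_subset)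
  from finite_distinct_list[OF this] obtain Ms where Ms: "set Ms = rep ` M" "distinct Ms"
    by (elim exE conjE)
  have "\<exists>!W. W \<in> set Ms \<and> R X W" if X: "X \<in> M" for X
  proof (rule ex1I[of _ "rep X"])
    show "rep X \<in> set Ms \<and> R X (rep X)" using X rep Ms by blast
    show "W = rep X" if W: "W \<in> set Ms \<and> R X W" for W
    proof -
      obtain Y where Y: "Y \<in> M" "W = rep Y" using W Ms by blast
      have "rep Y = rep W" "rep X = rep W"
        using rep_cong W Y rep X by blast+
      then show ?thesis using Y by simp
    qed
  qed
  then have "maximal_representatives G T U Ms"
    unfolding maximal_representatives_def R_def[symmetric]
    using Ms rep by (auto simp: M_def)
  then show ?thesis ..
qed

lemma embedding_conjugates_exist:
  assumes fin: "finite (carrier G)" and T: "subgroup T G"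
  shows "\<exists>L. embedding_conjugates G T W U L"
proof -
  have "finite T" using fin subgroup.subset[OF T] by (rule finite_subset[rotated])
  then have "finite {conj_subgroup G W g | g. g \<in> T \<and> U \<subset> conj_subgroup G W g}" by simp
  from finite_distinct_list[OF this] show ?thesis
    unfolding embedding_conjugates_def by blast
qed

lemma set_embedding_conjugates_of_representatives:
  assumes U: "subgroup U G"
    and Ms: "maximal_representatives G T U Ms"
    and V: "\<And>W. W \<in> set Ms \<Longrightarrow> embedding_conjugates G T W U (V W)"
  shows "set (concat (map V Ms)) = maximal_above G U T - {U}"
proof (intro equalityI subsetI)
  fix X assume "X \<in> set (concat (map V Ms))"
  then obtain W where W: "W \<in> set Ms" "X \<in> set (V W)" by auto
  then obtain g where g: "g \<in> T" "X = conj_subgroup G W g" "U \<subset> X"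
    using V by (auto simp: embedding_conjugates_def)
  have "maximal_subgroup G T W" using Ms W by (simp add: maximal_representatives_def)
  then show "X \<in> maximal_above G U T - {U}"
    using maximal_subgroup_conj g by (auto simp: maximal_above_def)
next
  fix X assume X: "X \<in> maximal_above G U T - {U}"
  then have max: "maximal_subgroup G T X" and UX: "U \<subset> X" by (auto simp: maximal_above_def)
  then have "card U dvd card X"
    using U by (intro card_subgroup_dvd) (auto simp: maximal_subgroup_def)
  then have "\<exists>!W. W \<in> set Ms \<and> (\<exists>g \<in> T. X = conj_subgroup G W g)"
    using Ms max by (simp add: maximal_representatives_def)
  then obtain W g where W: "W \<in> set Ms" "g \<in> T" "X = conj_subgroup G W g"
    by (elim ex1E conjE bexE)
  then have "X \<in> set (V W)"
    using V[of W] UX by (auto simp: embedding_conjugates_def)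
  then show "X \<in> set (concat (map V Ms))" using W by auto
qed

lemma distinct_embedding_conjugates_of_representatives:
  assumes U: "subgroup U G"
    and Ms: "maximal_representatives G T U Ms"
    and V: "\<And>W. W \<in> set Ms \<Longrightarrow> embedding_conjugates G T W U (V W)"
  shows "distinct (concat (map V Ms))"
proof -
  have disjoint: "set (V W) \<inter> set (V W') = {}"
    if W: "W \<in> set Ms" "W' \<in> set Ms" "W \<noteq> W'" for W W'
  proof (rule ccontr)
    assume "set (V W) \<inter> set (V W') \<noteq> {}"
    then obtain X where X: "X \<in> set (V W)" "X \<in> set (V W')" by blast
    have "X \<in> maximal_above G U T"
      using set_embedding_conjugates_of_representatives[OF U Ms V] X(1) W(1) by auto
    then have max: "maximal_subgroup G T X" and "U \<subseteq> X" by (auto simp: maximal_above_def)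
    then have "card U dvd card X"
      using U by (intro card_subgroup_dvd) (auto simp: maximal_subgroup_def)
    then have "\<exists>!W. W \<in> set Ms \<and> (\<exists>g \<in> T. X = conj_subgroup G W g)"
      using Ms max by (simp add: maximal_representatives_def)
    moreover have "\<exists>g \<in> T. X = conj_subgroup G W g" "\<exists>g \<in> T. X = conj_subgroup G W' g"
      using X V W by (auto simp: embedding_conjugates_def)
    ultimately show False using W by blast
  qed
  (* Several of the lists may be empty and hence equal, so the lists as such need not be distinct. *)
  have "distinct (concat (map V Ns))" if "distinct Ns" "set Ns \<subseteq> set Ms" for Ns
    using that
  proof (induction Ns)
    case (Cons W Ns)
    have "set (V W) \<inter> set (V W') = {}" if "W' \<in> set Ns" for W'
      using disjoint[of W W'] Cons.prems that by auto
    then show ?case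
      using Cons V by (auto simp: embedding_conjugates_def)
  qed simp
  then show ?thesis using Ms by (simp add: maximal_representatives_def)
qed

section \<open>One pass through the loop\<close>

text \<open>
  A description of the effect that is the same for both branches of the loop body and does not
  depend on the choice of representatives; the invariant needs nothing else about a pass.
\<close>

lemma isub_step_effect:
  assumes fin: "finite (carrier G)" and U: "subgroup U G"
    and step: "isub_step G U (S, P, I) (S', P', I')"
    and S: "\<And>T. T \<in> set S \<Longrightarrow> subgroup T G \<and> U \<subseteq> T"
  obtains T Rs where "T \<in> set S" "T \<notin> P" "P' = insert T P"
    "distinct S' \<longleftrightarrow> distinct S" "set S' = set S \<union> (maximal_above G U T - {U})"
    "I' = I @ map (\<lambda>X. (X, T)) Rs" "distinct Rs" "set Rs = maximal_above G U T"
  using step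
proof cases
  case (prime_index T)
  have "maximal_above G U T = {U}"
    using maximal_above_prime_index[OF fin _ U] S prime_index by blast
  then show ?thesis
    using prime_index that[of T "[U]"] by simp
next
  case (other_index T Ms V Xs)
  have T: "subgroup T G" using S other_index(4) by blast
  note V = other_index(8)[rule_format]
  have setXs: "set Xs = maximal_above G U T - {U}"
    using set_embedding_conjugates_of_representatives[OF U other_index(7) V]
    by (simp add: other_index(9))
  have dXs: "distinct Xs"
    using distinct_embedding_conjugates_of_representatives[OF U other_index(7) V]
    by (simp add: other_index(9))
  have "(\<forall>W\<in>set Ms. V W = []) \<longleftrightarrow> maximal_above G U T - {U} = {}"
    unfolding setXs[symmetric] other_index(9) by auto
  then have test: "(\<forall>W\<in>set Ms. V W = []) \<and> U \<subset> T \<longleftrightarrow> U \<in> maximal_above G U T"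
    using bottom_in_maximal_above_iff[OF fin T U] by blast
  define Rs where "Rs = Xs @ (if U \<in> maximal_above G U T then [U] else [])"
  show ?thesis
  proof (rule that[of T Rs])
    show "distinct S' \<longleftrightarrow> distinct S" "set S' = set S \<union> (maximal_above G U T - {U})"
      using other_index(1) setXs by (auto simp flip: List.union_def)
    show "I' = I @ map (\<lambda>X. (X, T)) Rs"
      using other_index(3) unfolding test by (simp add: Rs_def)
    show "distinct Rs" "set Rs = maximal_above G U T"
      using setXs dXs by (auto simp: Rs_def)
  qed (fact other_index(4,5,2))+
qed

lemma isub_step_exists:
  assumes fin: "finite (carrier G)"
    and T: "T \<in> set S" "T \<notin> P" "subgroup T G"
  shows "\<exists>s'. isub_step G U (S, P, I) s'"
proof (cases "prime (subgroup_index G T U)")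
  case True
  then show ?thesis using T isub_step.prime_index by blast
next
  case False
  obtain Ms where Ms: "maximal_representatives G T U Ms"
    using maximal_representatives_exist[OF fin T(3), of U] by (elim exE)
  have "\<forall>W. \<exists>L. embedding_conjugates G T W U L"
    by (intro allI embedding_conjugates_exist fin T(3))
  from choice[OF this] obtain V where V: "\<forall>W. embedding_conjugates G T W U (V W)"
    by (elim exE)
  have "\<forall>W\<in>set Ms. embedding_conjugates G T W U (V W)" using V by simp
  from isub_step.other_index[OF T(1,2) False Ms this refl] show ?thesis by (rule exI)
qed

end

section \<open>The invariant of the loop\<close>

definition isub_invariant :: "('a, 'b) monoid_scheme \<Rightarrow> 'a set \<Rightarrow> 'a isub_state \<Rightarrow> bool" where
  "isub_invariant G U s \<longleftrightarrow> (case s of (S, P, I) \<Rightarrow>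
     distinct S \<and> carrier G \<in> set S \<and>
     (\<forall>T\<in>set S. subgroup T G \<and> (T = carrier G \<or> U \<subset> T)) \<and>
     P \<subseteq> set S \<and>
     (\<forall>T\<in>P. maximal_above G U T - {U} \<subseteq> set S) \<and>
     distinct I \<and> set I = {(X, T). T \<in> P \<and> X \<in> maximal_above G U T})"

context group
begin

lemma isub_invariant_init: "isub_invariant G U (isub_init G)"
  by (simp add: isub_invariant_def isub_init_def subgroup_self)

lemma isub_invariant_above:
  assumes "subgroup U G" "isub_invariant G U (S, P, I)" "T \<in> set S"
  shows "subgroup T G \<and> U \<subseteq> T"
  using assms subgroup.subset[OF assms(1)] by (auto simp: isub_invariant_def)

lemma isub_invariant_step:
  assumes fin: "finite (carrier G)" and U: "subgroup U G"
    and inv: "isub_invariant G U s" and step: "isub_step G U s s'"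
  shows "isub_invariant G U s'"
proof -
  obtain S P I where s: "s = (S, P, I)" by (cases s)
  obtain S' P' I' where s': "s' = (S', P', I')" by (cases s')
  obtain T Rs where T: "T \<in> set S" "T \<notin> P" "P' = insert T P"
    and S': "distinct S' \<longleftrightarrow> distinct S" "set S' = set S \<union> (maximal_above G U T - {U})"
    and I': "I' = I @ map (\<lambda>X. (X, T)) Rs" and Rs: "distinct Rs" "set Rs = maximal_above G U T"
    using isub_step_effect[OF fin U step[unfolded s s'] isub_invariant_above[OF U inv[unfolded s]]]
    by blast
  have "distinct I'" "set I' = {(X, T). T \<in> P' \<and> X \<in> maximal_above G U T}"
    using inv T I' Rs by (auto simp: s isub_invariant_def distinct_map inj_on_def)
  moreover have "subgroup X G \<and> U \<subset> X" if "X \<in> maximal_above G U T - {U}" for X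
    using that by (auto simp: maximal_above_def maximal_subgroup_def)
  ultimately show ?thesis
    using inv T S' unfolding s s' isub_invariant_def by auto
qed

lemma isub_invariant_reachable:
  assumes fin: "finite (carrier G)" and U: "subgroup U G"
    and "(isub_step G U)\<^sup>*\<^sup>* (isub_init G) s"
  shows "isub_invariant G U s"
  using assms(3)
  by (induction rule: rtranclp_induct) (auto intro: isub_invariant_init isub_invariant_step[OF fin U])

section \<open>Termination and correctness\<close>

lemma isub_terminates:
  assumes fin: "finite (carrier G)" and U: "subgroup U G"
  shows "isub_terminates G U"
  unfolding isub_terminates_def
proof (intro conjI notI allI impI)
  assume "\<exists>f. f 0 = isub_init G \<and> (\<forall>n::nat. isub_step G U (f n) (f (Suc n)))"
  then obtain f where f0: "f 0 = isub_init G" and f: "\<And>n. isub_step G U (f n) (f (Suc n))"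
    by blast
  define Q where "Q n = fst (snd (f n))" for n
  have inv: "isub_invariant G U (f n)" for n
    by (induction n) (use f0 f isub_invariant_init isub_invariant_step[OF fin U] in auto)
  have Q_sub: "Q n \<subseteq> Pow (carrier G)" for n
  proof -
    obtain S P I where fn: "f n = (S, P, I)" by (cases "f n")
    have "\<forall>T\<in>P. subgroup T G" using inv[of n] unfolding fn isub_invariant_def by auto
    then show ?thesis using subgroup.subset by (auto simp: Q_def fn)
  qed
  have Q_fin: "finite (Q n)" for n
    using Q_sub fin by (meson finite_Pow_iff finite_subset)
  have "Q n \<subset> Q (Suc n)" for n
    using f[of n] unfolding Q_def by (cases rule: isub_step.cases) auto
  then have "card (Q n) < card (Q (Suc n))" for n
    using Q_fin by (simp add: psubset_card_mono)
  then have "strict_mono (\<lambda>n. card (Q n))" by (simp add: strict_mono_Suc_iff)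
  then have "n \<le> card (Q n)" for n by (rule strict_mono_imp_increasing)
  moreover have "card (Q n) \<le> card (Pow (carrier G))" for n
    using Q_sub fin by (simp add: card_mono)
  ultimately show False by (meson not_less_eq_eq order.trans)
next
  fix s assume s: "(isub_step G U)\<^sup>*\<^sup>* (isub_init G) s \<and> \<not> isub_done s"
  obtain S P I where eq: "s = (S, P, I)" by (cases s)
  have inv: "isub_invariant G U (S, P, I)"
    using isub_invariant_reachable[OF fin U] s eq by blast
  obtain T where "T \<in> set S" "T \<notin> P" using s eq by (auto simp: isub_done_def)
  then show "\<exists>s'. isub_step G U s s'"
    using isub_step_exists[OF fin] isub_invariant_above[OF U inv] eq by blast
qed

text \<open>
  A smallest member of \<open>\<S>\<close> properly above a missing \<open>V\<close> would have a maximal subgroup above \<open>V\<close>,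
  which lies in \<open>\<S>\<close> and is smaller still.
\<close>

lemma maximal_closed_contains_all:
  assumes fin: "finite (carrier G)"
    and top: "carrier G \<in> \<S>" and sub: "\<And>T. T \<in> \<S> \<Longrightarrow> subgroup T G"
    and closed: "\<And>T. T \<in> \<S> \<Longrightarrow> maximal_above G U T - {U} \<subseteq> \<S>"
    and V: "subgroup V G" "U \<subset> V"
  shows "V \<in> \<S>"
proof (rule ccontr)
  assume "V \<notin> \<S>"
  let ?A = "{T \<in> \<S>. V \<subset> T}"
  have "?A \<subseteq> Pow (carrier G)" using sub subgroup.subset by blast
  then have "finite ?A" using fin by (simp add: finite_subset)
  moreover have "carrier G \<in> ?A"
    using top \<open>V \<notin> \<S>\<close> subgroup.subset[OF V(1)] by blast
  ultimately have "\<exists>T\<in>?A. T \<subseteq> carrier G \<and> (\<forall>X\<in>?A. X \<subseteq> T \<longrightarrow> T = X)"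
    by (rule finite_has_minimal2)
  then obtain T where T: "T \<in> ?A" and min: "\<forall>X\<in>?A. X \<subseteq> T \<longrightarrow> T = X"
    by (elim bexE conjE)
  have "subgroup T G" "V \<subset> T" using T sub by simp_all
  then obtain X where X: "maximal_subgroup G T X" "V \<subseteq> X"
    by (rule contained_in_maximal_subgroup[OF fin V(1)])
  then have "X \<in> maximal_above G U T - {U}" using V(2) by (auto simp: maximal_above_def)
  then have "X \<in> ?A" using closed T X(2) \<open>V \<notin> \<S>\<close> by blast
  then show False using min X(1) by (auto simp: maximal_subgroup_def)
qed

lemma isub_returns_correct:
  assumes fin: "finite (carrier G)" and U: "subgroup U G" and ret: "isub_returns G U S I"
  shows "distinct S" "distinct I"
    and "set S = insert (carrier G) {V. subgroup V G \<and> U \<subset> V \<and> V \<subset> carrier G}"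
    and "set I = {(X, T). subgroup X G \<and> subgroup T G \<and> U \<subseteq> X \<and> X \<subset> T \<and> T \<subseteq> carrier G \<and>
                         maximal_subgroup G T X}"
proof -
  obtain P where reach: "(isub_step G U)\<^sup>*\<^sup>* (isub_init G) (S, P, I)" and "set S \<subseteq> P"
    using ret by (auto simp: isub_returns_def isub_done_def)
  note inv = isub_invariant_reachable[OF fin U reach]
  have P: "P = set S" using inv \<open>set S \<subseteq> P\<close> by (auto simp: isub_invariant_def)
  show "distinct S" "distinct I" using inv by (auto simp: isub_invariant_def)
  have all: "V \<in> set S" if "subgroup V G" "U \<subset> V" for V
    by (rule maximal_closed_contains_all[OF fin _ _ _ that])
      (use inv P in \<open>auto simp: isub_invariant_def\<close>)
  have "carrier G \<in> set S" "\<forall>T\<in>set S. subgroup T G \<and> (T = carrier G \<or> U \<subset> T)"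
    using inv by (simp_all add: isub_invariant_def)
  then show "set S = insert (carrier G) {V. subgroup V G \<and> U \<subset> V \<and> V \<subset> carrier G}"
    using all subgroup.subset[of _ G] by auto
  have "T \<in> set S \<and> X \<in> maximal_above G U T \<longleftrightarrow>
      subgroup X G \<and> subgroup T G \<and> U \<subseteq> X \<and> X \<subset> T \<and> T \<subseteq> carrier G \<and> maximal_subgroup G T X" for X T
    using all[of T] subgroup.subset[of T G]
    unfolding maximal_above_def maximal_subgroup_def by blast
  then show "set I = {(X, T). subgroup X G \<and> subgroup T G \<and> U \<subseteq> X \<and> X \<subset> T \<and> T \<subseteq> carrier G \<and>
                         maximal_subgroup G T X}"
    using inv P by (simp add: isub_invariant_def)
qed

end

theorem mainTheorem1:
  fixes G :: "('a, 'b) monoid_scheme" and U :: "'a set"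
  assumes "group G" and "finite (carrier G)" and "subgroup U G"
  shows "isub_terminates G U \<and>
    (\<forall>S I. isub_returns G U S I \<longrightarrow>
       (distinct S \<and>
        set S = insert (carrier G) {V. subgroup V G \<and> U \<subset> V \<and> V \<subset> carrier G}) \<and>
       (distinct I \<and>
        set I = {(X, T). subgroup X G \<and> subgroup T G \<and> U \<subseteq> X \<and> X \<subset> T \<and> T \<subseteq> carrier G \<and>
                         maximal_subgroup G T X}))"
  using group.isub_terminates[OF assms] group.isub_returns_correct[OF assms] by simp

end
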